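(* Let $\langle\mathbb{A},\Rightarrow\!\!>,\Rightarrow,[\top,\top]\rangle$ be an IBCI-algebra (or IBCK-algebra) obtained from $\langle A,\rightarrow,\top\rangle$. Then for all $X,Y\in\mathbb{A}$: (1) $X\Rightarrow\!\!> X=[\overline{X}\rightarrow\underline{X},\top]$; (2) $X\Rightarrow\!\!> Y=[\top,\top]$ iff $\overline{X}\preceq\underline{Y}$.
   Context: A BCI-algebra is a structure $\langle A,\rightarrow,\top\rangle$ such that for all $x,y,z\in A$: (C1) $(y\rightarrow z)\rightarrow((z\rightarrow x)\rightarrow(y\rightarrow x))=\top$; (C2) $x\rightarrow((x\rightarrow y)\rightarrow y)=\top$; (C3) $x\rightarrow x=\top$; (C4) $x\rightarrow y=\top$ and $y\rightarrow x=\top$ imply $x=y$; its induced order is $x\preceq y$ iff $x\rightarrow y=\top$; it is a BCK-algebra if moreover $x\rightarrow\top=\top$ for all $x$. Given a BCI- (resp. BCK-) algebra $\langle A,\rightarrow,\top\rangle$ such that $\langle A,\preceq\rangle$ is a meet-semilattice with $x\rightarrow(y\wedge z)=(x\rightarrow y)\wedge(x\rightarrow z)$ for all $x,y,z$, let $\mathbb{A}=\{[a,b]:a,b\in A,\ a\preceq b\}$, with $\underline{[a,b]}=a$, $\overline{[a,b]}=b$, and define $X\Rightarrow\!\!> Y=[\overline{X}\rightarrow\underline{Y},\ \underline{X}\rightarrow\overline{Y}]$ and $X\Rightarrow Y=[(\underline{X}\rightarrow\underline{Y})\wedge(\overline{X}\rightarrow\overline{Y}),\ \underline{X}\rightarrow\overline{Y}]$.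 The structure $\langle\mathbb{A},\Rightarrow\!\!>,\Rightarrow,[\top,\top]\rangle$ is called the interval BCI- (resp. BCK-) algebra, IBCI (IBCK). *)

theory Defs
  imports "HOL-Algebra.Lattice"
begin

section \<open>BCI- and BCK-algebras\<close>

text \<open>The top element is printed in bold to keep it apart from the lattice top of
  \<^theory>\<open>HOL-Algebra.Order\<close>: in a BCI-algebra it is in general only a maximal element.\<close>

record 'a implication_algebra = "'a partial_object" +
  imp :: "'a \<Rightarrow> 'a \<Rightarrow> 'a" (infixr \<open>\<leadsto>\<index>\<close> 65)
  truth :: 'a (\<open>\<^bold>\<top>\<index>\<close>)

locale bci_algebra =
  fixes A :: "('a, 'm) implication_algebra_scheme" (structure)
  assumes imp_closed: "\<lbrakk>x \<in> carrier A; y \<in> carrier A\<rbrakk> \<Longrightarrow> x \<leadsto> y \<in> carrier A"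
    and truth_closed: "\<^bold>\<top> \<in> carrier A"
    and C1: "\<lbrakk>x \<in> carrier A; y \<in> carrier A; z \<in> carrier A\<rbrakk>
      \<Longrightarrow> (y \<leadsto> z) \<leadsto> ((z \<leadsto> x) \<leadsto> (y \<leadsto> x)) = \<^bold>\<top>"
    and C2: "\<lbrakk>x \<in> carrier A; y \<in> carrier A\<rbrakk> \<Longrightarrow> x \<leadsto> ((x \<leadsto> y) \<leadsto> y) = \<^bold>\<top>"
    and C3: "x \<in> carrier A \<Longrightarrow> x \<leadsto> x = \<^bold>\<top>"
    and C4: "\<lbrakk>x \<in> carrier A; y \<in> carrier A; x \<leadsto> y = \<^bold>\<top>; y \<leadsto> x = \<^bold>\<top>\<rbrakk> \<Longrightarrow> x = y"

locale bck_algebra = bci_algebra +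
  assumes imp_truth: "x \<in> carrier A \<Longrightarrow> x \<leadsto> \<^bold>\<top> = \<^bold>\<top>"

definition induced_order :: "('a, 'm) implication_algebra_scheme \<Rightarrow> 'a gorder" where
  "induced_order A = \<lparr>carrier = carrier A, eq = (=), le = (\<lambda>x y. x \<leadsto>\<^bsub>A\<^esub> y = \<^bold>\<top>\<^bsub>A\<^esub>)\<rparr>"

abbreviation preceq :: "[_, 'a, 'a] \<Rightarrow> bool" (infix \<open>\<preceq>\<index>\<close> 50) where
  "x \<preceq>\<^bsub>A\<^esub> y \<equiv> x \<sqsubseteq>\<^bsub>induced_order A\<^esub> y"

abbreviation wedge :: "[_, 'a, 'a] \<Rightarrow> 'a" (infixl \<open>\<^bold>\<and>\<index>\<close> 70) where
  "x \<^bold>\<and>\<^bsub>A\<^esub> y \<equiv> x \<sqinter>\<^bsub>induced_order A\<^esub> y"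

locale meet_bci_algebra = bci_algebra +
  assumes meet_semilattice: "lower_semilattice (induced_order A)"
    and imp_meet: "\<lbrakk>x \<in> carrier A; y \<in> carrier A; z \<in> carrier A\<rbrakk>
      \<Longrightarrow> x \<leadsto> (y \<^bold>\<and> z) = (x \<leadsto> y) \<^bold>\<and> (x \<leadsto> z)"

locale meet_bck_algebra = meet_bci_algebra + bck_algebra


section \<open>Interval algebras\<close>

text \<open>An interval is the set of elements between its endpoints. Antisymmetry makes the endpoints
  unique when \<open>a \<preceq> b\<close> (lemmas \<open>lower_end_interval\<close>, \<open>upper_end_interval\<close>), and
  the results of both operations again have ordered endpoints (\<open>interval_algebra_closed\<close>).\<close>

abbreviation interval :: "[_, 'a, 'a] \<Rightarrow> 'a set" (\<open>\<^bold>[_,/ _\<^bold>]\<index>\<close>) where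
  "\<^bold>[a, b\<^bold>]\<^bsub>A\<^esub> \<equiv> \<lbrace>a..b\<rbrace>\<^bsub>induced_order A\<^esub>"

definition intervals :: "('a, 'm) implication_algebra_scheme \<Rightarrow> 'a set set" where
  "intervals A = {\<^bold>[a, b\<^bold>]\<^bsub>A\<^esub> | a b. a \<in> carrier A \<and> b \<in> carrier A \<and> a \<preceq>\<^bsub>A\<^esub> b}"

definition lower_end :: "('a, 'm) implication_algebra_scheme \<Rightarrow> 'a set \<Rightarrow> 'a" where
  "lower_end A X =
    (THE a. \<exists>b. a \<in> carrier A \<and> b \<in> carrier A \<and> a \<preceq>\<^bsub>A\<^esub> b \<and> X = \<^bold>[a, b\<^bold>]\<^bsub>A\<^esub>)"

definition upper_end :: "('a, 'm) implication_algebra_scheme \<Rightarrow> 'a set \<Rightarrow> 'a" where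
  "upper_end A X =
    (THE b. \<exists>a. a \<in> carrier A \<and> b \<in> carrier A \<and> a \<preceq>\<^bsub>A\<^esub> b \<and> X = \<^bold>[a, b\<^bold>]\<^bsub>A\<^esub>)"

record 'b two_implication_algebra = "'b partial_object" +
  outer_imp :: "'b \<Rightarrow> 'b \<Rightarrow> 'b" (infixr \<open>\<Rrightarrow>\<index>\<close> 65)
  inner_imp :: "'b \<Rightarrow> 'b \<Rightarrow> 'b" (infixr \<open>\<^bold>\<Rightarrow>\<index>\<close> 65)
  unit_interval :: 'b

definition interval_algebra ::
    "('a, 'm) implication_algebra_scheme \<Rightarrow> 'a set two_implication_algebra" where
  "interval_algebra A =
    \<lparr>carrier = intervals A,
     outer_imp = (\<lambda>X Y.
       \<^bold>[upper_end A X \<leadsto>\<^bsub>A\<^esub> lower_end A Y, lower_end A X \<leadsto>\<^bsub>A\<^esub> upper_end A Y\<^bold>]\<^bsub>A\<^esub>),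
     inner_imp = (\<lambda>X Y.
       \<^bold>[(lower_end A X \<leadsto>\<^bsub>A\<^esub> lower_end A Y) \<^bold>\<and>\<^bsub>A\<^esub> (upper_end A X \<leadsto>\<^bsub>A\<^esub> upper_end A Y),
        lower_end A X \<leadsto>\<^bsub>A\<^esub> upper_end A Y\<^bold>]\<^bsub>A\<^esub>),
     unit_interval = \<^bold>[\<^bold>\<top>\<^bsub>A\<^esub>, \<^bold>\<top>\<^bsub>A\<^esub>\<^bold>]\<^bsub>A\<^esub>\<rparr>"

definition IBCI_algebra_from ::
    "('a, 'm) implication_algebra_scheme \<Rightarrow> 'a set two_implication_algebra \<Rightarrow> bool" where
  "IBCI_algebra_from A I \<longleftrightarrow> meet_bci_algebra A \<and> I = interval_algebra A"

definition IBCK_algebra_from ::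
    "('a, 'm) implication_algebra_scheme \<Rightarrow> 'a set two_implication_algebra \<Rightarrow> bool" where
  "IBCK_algebra_from A I \<longleftrightarrow> meet_bck_algebra A \<and> I = interval_algebra A"


section \<open>Well-definedness of endpoints and operations\<close>

lemma induced_order_simps [simp]:
  "carrier (induced_order A) = carrier A"
  "eq (induced_order A) = (=)"
  "x \<preceq>\<^bsub>A\<^esub> y \<longleftrightarrow> x \<leadsto>\<^bsub>A\<^esub> y = \<^bold>\<top>\<^bsub>A\<^esub>"
  by (simp_all add: induced_order_def)

context meet_bci_algebra
begin

interpretation ord: lower_semilattice "induced_order A"
  by (rule meet_semilattice)

lemma truth_impD:
  assumes "x \<in> carrier A" "\<^bold>\<top> \<leadsto> x = \<^bold>\<top>" shows "x = \<^bold>\<top>"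
  by (metis C2 C3 C4 assms truth_closed)

lemma truth_imp: "x \<in> carrier A \<Longrightarrow> \<^bold>\<top> \<leadsto> x = x"
  by (metis C2 C3 C4 imp_closed truth_closed truth_impD)

lemma imp_antimono:
  assumes "x \<in> carrier A" "y \<in> carrier A" "z \<in> carrier A" "x \<preceq> y"
  shows "y \<leadsto> z \<preceq> x \<leadsto> z"
  using C1[of z x y] assms by (simp add: imp_closed truth_impD)

lemma imp_mono:
  assumes "x \<in> carrier A" "y \<in> carrier A" "z \<in> carrier A" "x \<preceq> y"
  shows "z \<leadsto> x \<preceq> z \<leadsto> y"
  using C1[of y z x] assms by (simp add: imp_closed truth_imp)

lemma interval_eq_iff:
  assumes "a \<in> carrier A" "b \<in> carrier A" "c \<in> carrier A" "d \<in> carrier A" "a \<preceq> b" "c \<preceq> d"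
  shows "\<^bold>[a, b\<^bold>] = \<^bold>[c, d\<^bold>] \<longleftrightarrow> a = c \<and> b = d"
proof
  assume eq: "\<^bold>[a, b\<^bold>] = \<^bold>[c, d\<^bold>]"
  have "a \<in> \<^bold>[a, b\<^bold>]" "b \<in> \<^bold>[a, b\<^bold>]" "c \<in> \<^bold>[c, d\<^bold>]" "d \<in> \<^bold>[c, d\<^bold>]"
    using assms by (auto simp: at_least_at_most_def C3)
  then have "a \<in> \<^bold>[c, d\<^bold>]" "b \<in> \<^bold>[c, d\<^bold>]" "c \<in> \<^bold>[a, b\<^bold>]" "d \<in> \<^bold>[a, b\<^bold>]"
    using eq by simp_all
  then show "a = c \<and> b = d"
    using assms C4 by (simp add: at_least_at_most_def)
qed simp

lemma
  assumes "a \<in> carrier A" "b \<in> carrier A" "a \<preceq> b"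
  shows lower_end_interval: "lower_end A \<^bold>[a, b\<^bold>] = a"
    and upper_end_interval: "upper_end A \<^bold>[a, b\<^bold>] = b"
  unfolding lower_end_def upper_end_def using assms interval_eq_iff by blast+

lemma interval_algebra_closed:
  assumes "X \<in> intervals A" "Y \<in> intervals A"
  shows "X \<Rrightarrow>\<^bsub>interval_algebra A\<^esub> Y \<in> intervals A"
    and "X \<^bold>\<Rightarrow>\<^bsub>interval_algebra A\<^esub> Y \<in> intervals A"
    and "unit_interval (interval_algebra A) \<in> intervals A"
proof -
  obtain a b where X: "a \<in> carrier A" "b \<in> carrier A" "a \<preceq> b" "X = \<^bold>[a, b\<^bold>]"
    using assms(1) by (auto simp: intervals_def)
  obtain c d where Y: "c \<in> carrier A" "d \<in> carrier A" "c \<preceq> d" "Y = \<^bold>[c, d\<^bold>]"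
    using assms(2) by (auto simp: intervals_def)
  note ends = lower_end_interval[OF X(1-3)] upper_end_interval[OF X(1-3)]
    lower_end_interval[OF Y(1-3)] upper_end_interval[OF Y(1-3)]
  have cl: "b \<leadsto> c \<in> carrier (induced_order A)" "a \<leadsto> c \<in> carrier (induced_order A)"
    "b \<leadsto> d \<in> carrier (induced_order A)" "a \<leadsto> d \<in> carrier (induced_order A)"
    using X Y imp_closed by simp_all
  have 1: "b \<leadsto> c \<preceq> a \<leadsto> c" using X Y imp_antimono by blast
  have 2: "a \<leadsto> c \<preceq> a \<leadsto> d" using X Y imp_mono by blast
  have 3: "(a \<leadsto> c) \<^bold>\<and> (b \<leadsto> d) \<in> carrier (induced_order A)"
    using cl ord.meet_closed by blast
  have 4: "(a \<leadsto> c) \<^bold>\<and> (b \<leadsto> d) \<preceq> a \<leadsto> c"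
    using cl ord.meet_left by blast
  have 5: "b \<leadsto> c \<preceq> a \<leadsto> d" using ord.le_trans[OF 1 2] cl by blast
  have 6: "(a \<leadsto> c) \<^bold>\<and> (b \<leadsto> d) \<preceq> a \<leadsto> d" using ord.le_trans[OF 4 2] cl 3 by blast
  show "X \<Rrightarrow>\<^bsub>interval_algebra A\<^esub> Y \<in> intervals A"
    unfolding interval_algebra_def intervals_def X(4) Y(4)
    using cl 5 by (auto simp: ends simp del: induced_order_simps(3))
  show "X \<^bold>\<Rightarrow>\<^bsub>interval_algebra A\<^esub> Y \<in> intervals A"
    unfolding interval_algebra_def intervals_def X(4) Y(4)
    using cl 3 6 by (auto simp: ends simp del: induced_order_simps(3))
  show "unit_interval (interval_algebra A) \<in> intervals A"
    unfolding interval_algebra_def intervals_def using truth_closed C3 by auto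
qed

end

end

theory Submission
  imports Defs
begin

text \<open>For X = [a, b] and Y = [c, d], the outer implication is
  [b \<leadsto> c, a \<leadsto> d]. With Y = X its upper end is a \<leadsto> b, which is \<top>
  because a \<preceq> b. For the criterion, \<open>imp_endpoints_preceq\<close> orders the two ends,
  so \<open>interval_eq_iff\<close> lets them be compared with \<top> separately; since only \<top>
  lies above \<top>, the lower end decides.\<close>

context meet_bci_algebra
begin

text \<open>Antitonicity gives (y \<leadsto> z) \<leadsto> (x \<leadsto> z) = \<top>; the premise
  turns y \<leadsto> z into \<top>, and \<open>truth_impD\<close> then forces x \<leadsto> z =
  \<top>.\<close>

lemma preceq_trans:
  assumes "x \<in> carrier A" "y \<in> carrier A" "z \<in> carrier A" "x \<preceq> y" "y \<preceq> z"
  shows "x \<preceq> z"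
  using imp_antimono[OF assms(1-4)] assms by (simp add: imp_closed truth_impD)

text \<open>The chain passes through a \<leadsto> c: shrink the antecedent from b to a, then enlarge
  the consequent from c to d.\<close>

lemma imp_endpoints_preceq:
  assumes "a \<in> carrier A" "b \<in> carrier A" "c \<in> carrier A" "d \<in> carrier A" "a \<preceq> b" "c \<preceq> d"
  shows "b \<leadsto> c \<preceq> a \<leadsto> d"
  using preceq_trans[OF _ _ _ imp_antimono imp_mono] assms imp_closed by blast

lemma outer_imp_self:
  assumes "X \<in> intervals A"
  shows "X \<Rrightarrow>\<^bsub>interval_algebra A\<^esub> X = \<^bold>[upper_end A X \<leadsto> lower_end A X, \<^bold>\<top>\<^bold>]"
proof -
  obtain a b where "a \<in> carrier A" "b \<in> carrier A" "a \<preceq> b" "X = \<^bold>[a, b\<^bold>]"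
    using assms by (auto simp: intervals_def)
  then show ?thesis
    by (simp add: interval_algebra_def lower_end_interval upper_end_interval)
qed

lemma outer_imp_eq_unit_iff:
  assumes "X \<in> intervals A" "Y \<in> intervals A"
  shows "X \<Rrightarrow>\<^bsub>interval_algebra A\<^esub> Y = \<^bold>[\<^bold>\<top>, \<^bold>\<top>\<^bold>] \<longleftrightarrow> upper_end A X \<preceq> lower_end A Y"
proof -
  obtain a b where X: "a \<in> carrier A" "b \<in> carrier A" "a \<preceq> b" "X = \<^bold>[a, b\<^bold>]"
    using assms(1) by (auto simp: intervals_def)
  obtain c d where Y: "c \<in> carrier A" "d \<in> carrier A" "c \<preceq> d" "Y = \<^bold>[c, d\<^bold>]"
    using assms(2) by (auto simp: intervals_def)
  have le: "b \<leadsto> c \<preceq> a \<leadsto> d"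
    using imp_endpoints_preceq X Y by blast
  have "X \<Rrightarrow>\<^bsub>interval_algebra A\<^esub> Y = \<^bold>[b \<leadsto> c, a \<leadsto> d\<^bold>]"
    using X Y by (simp add: interval_algebra_def lower_end_interval upper_end_interval)
  also have "\<dots> = \<^bold>[\<^bold>\<top>, \<^bold>\<top>\<^bold>] \<longleftrightarrow> b \<leadsto> c = \<^bold>\<top> \<and> a \<leadsto> d = \<^bold>\<top>"
    \<comment> \<open>An interval determines its ends only when they are ordered: \<open>le\<close>
      ensures this on the left, \<open>C3\<close> on the right.\<close>
    using interval_eq_iff[OF _ _ truth_closed truth_closed le] X Y
    by (simp add: imp_closed truth_closed C3)
  also have "\<dots> \<longleftrightarrow> b \<leadsto> c = \<^bold>\<top>"
    \<comment> \<open>\<open>\<^bold>\<top>\<close> is maximal, so the upper endpoint is \<open>\<^bold>\<top>\<close> as soon as the lower one is.\<close>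
    using le X Y truth_impD by (auto simp: imp_closed)
  finally show ?thesis
    using X Y by (simp add: lower_end_interval upper_end_interval)
qed

end

theorem theorem3:
  fixes A :: "('a, 'm) implication_algebra_scheme"
    and I :: "'a set two_implication_algebra"
    and X Y :: "'a set"
  assumes "IBCI_algebra_from A I \<or> IBCK_algebra_from A I"
    and "X \<in> carrier I" and "Y \<in> carrier I"
  shows "X \<Rrightarrow>\<^bsub>I\<^esub> X = \<^bold>[upper_end A X \<leadsto>\<^bsub>A\<^esub> lower_end A X, \<^bold>\<top>\<^bsub>A\<^esub>\<^bold>]\<^bsub>A\<^esub>
    \<and> (X \<Rrightarrow>\<^bsub>I\<^esub> Y = \<^bold>[\<^bold>\<top>\<^bsub>A\<^esub>, \<^bold>\<top>\<^bsub>A\<^esub>\<^bold>]\<^bsub>A\<^esub> \<longleftrightarrow> upper_end A X \<preceq>\<^bsub>A\<^esub> lower_end A Y)"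
proof -
  \<comment> \<open>\<open>meet_bck_algebra\<close> extends \<open>meet_bci_algebra\<close>, so both
    cases land in the same locale.\<close>
  have A: "meet_bci_algebra A" and I: "I = interval_algebra A"
    using assms(1)
    by (auto simp: IBCI_algebra_from_def IBCK_algebra_from_def meet_bck_algebra_def)
  have "X \<in> intervals A" "Y \<in> intervals A"
    using assms(2,3) by (simp_all add: I interval_algebra_def)
  then show ?thesis
    unfolding I
    using meet_bci_algebra.outer_imp_self[OF A] meet_bci_algebra.outer_imp_eq_unit_iff[OF A]
    by blast
qed

end
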